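(* Let $G_0,G_1\in\mathbb{Z}$ and let $(G_n)_{n\ge 0}$ be defined by $G_n=G_{n-1}+G_{n-2}$ for all $n\ge 2$. For every positive integer $k$, $$\mathcal{G}_{G_0,G_1}(k)=\gcd(G_{k+1}-G_1,\;G_{k+2}-G_2).$$
   Context: For a positive integer $k$, $\mathcal{G}_{G_0,G_1}(k)$ denotes the greatest common divisor of all the integers $\sum_{i=0}^{k-1}G_{n+i}$ for $n\ge 1$, i.e., the largest integer dividing every sum of $k$ consecutive terms $G_n+G_{n+1}+\cdots+G_{n+k-1}$ with $n\ge 1$. *)

theory Defs
  imports Main
begin

fun gibonacci :: "int \<Rightarrow> int \<Rightarrow> nat \<Rightarrow> int" where
  "gibonacci G0 G1 0 = G0"
| "gibonacci G0 G1 (Suc 0) = G1"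
| "gibonacci G0 G1 (Suc (Suc n)) = gibonacci G0 G1 (Suc n) + gibonacci G0 G1 n"

text \<open>The library's \<^const>\<open>Gcd\<close> on \<^typ>\<open>int set\<close> is the nonnegative gcd of the set. It is the
  largest common divisor unless every element is 0, in which case it is 0,
  in agreement with \<^prop>\<open>gcd 0 0 = (0::int)\<close>.\<close>

definition gcd_consecutive_sums :: "int \<Rightarrow> int \<Rightarrow> nat \<Rightarrow> int" where
  "gcd_consecutive_sums G0 G1 k = Gcd {(\<Sum>i=0..<k. gibonacci G0 G1 (n + i)) | n. n \<ge> 1}"

end

theory Submission
  imports Defs
begin

text \<open>The sum of k consecutive terms telescopes to \<open>D n = G (n + k + 1) - G (n + 1)\<close>, and
  \<open>D\<close> satisfies the Fibonacci recurrence. Running the recurrence forwards, every common divisor of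
  \<open>D 0\<close> and \<open>D 1\<close> divides all \<open>D n\<close>; running it one step backwards, \<open>D 0 = D 2 - D 1\<close>.\<close>

lemma sum_gibonacci:
  "(\<Sum>i=0..<k. gibonacci a b (n + i)) = gibonacci a b (Suc (n + k)) - gibonacci a b (Suc n)"
  by (induction k) simp_all

lemma dvd_fibonacci_recurrence:
  fixes D :: "nat \<Rightarrow> 'a :: comm_semiring_1"
  assumes "\<And>n. D (Suc (Suc n)) = D (Suc n) + D n" and "d dvd D 0" and "d dvd D 1"
  shows "d dvd D n"
  by (induction n rule: induct_nat_012) (use assms in auto)

theorem theorem3p1:
  fixes G0 G1 :: int and k :: nat
  assumes "k \<ge> 1"
  shows "gcd_consecutive_sums G0 G1 k =
    gcd (gibonacci G0 G1 (k + 1) - gibonacci G0 G1 1)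
        (gibonacci G0 G1 (k + 2) - gibonacci G0 G1 2)"
proof -
  define D where "D n = gibonacci G0 G1 (Suc (n + k)) - gibonacci G0 G1 (Suc n)" for n
  have rec: "D (Suc (Suc n)) = D (Suc n) + D n" for n
    by (simp add: D_def)
  have "Gcd {D n | n. n \<ge> 1} = gcd (D 0) (D 1)"
  \<comment> \<open>Over \<open>int\<close>, mutual divisibility gives equality only up to sign;
    both gcds are nonnegative, which the closing \<open>simp_all\<close> checks.\<close>
  proof (rule zdvd_antisym_nonneg)
    let ?g = "Gcd {D n | n. n \<ge> 1}"
    have dvd: "?g dvd D n" if "n \<ge> 1" for n
      using that by (intro Gcd_dvd) blast
    \<comment> \<open>The set starts at \<open>n = 1\<close>, so \<open>D 0\<close> need not be one
      of its listed elements and must be recovered from \<open>D 1\<close> and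
      \<open>D 2\<close>.\<close>
    have "D 0 = D 2 - D 1"
      using rec[of 0] by (simp add: numeral_2_eq_2)
    then have "?g dvd D 0"
      using dvd[of 1] dvd[of 2] by simp
    then show "?g dvd gcd (D 0) (D 1)"
      using dvd[of 1] by simp
  next
    show "gcd (D 0) (D 1) dvd Gcd {D n | n. n \<ge> 1}"
      by (rule Gcd_greatest) (use dvd_fibonacci_recurrence[of D, OF rec] in auto)
  qed simp_all
  then show ?thesis
    \<comment> \<open>Unfolded, \<open>D 0\<close> and \<open>D 1\<close> are the two differences in
      the claim, once the numeral 2 is written with \<open>Suc\<close>.\<close>
    unfolding gcd_consecutive_sums_def sum_gibonacci D_def
    by (simp add: numeral_2_eq_2)
qed

end
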